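(* Let $f$ be a real form of degree $d\ge 2$ in $n$ variables and let $K\subset\mathbb{R}^n$ be a self-dual convex cone. Then $f\in\mathrm{SL}^d(K)$ if and only if for all $a_1,\dots,a_{d-2}\in\mathrm{int}\,K$ the matrix $Q$ of the quadratic form $q=D_{a_1}\cdots D_{a_{d-2}}f$ satisfies the following two conditions: (a) $Q$ is either nonsingular and $K$-irreducible, or singular and $K$-nonnegative; (b) $Q$ has exactly one positive eigenvalue.
   Context: $K$ is self-dual if $K=K^*=\{y : \langle y,x\rangle\ge 0\ \forall x\in K\}$. $D_af=\sum_i a_i\,\partial f/\partial x_i$. The matrix of a quadratic form $q$ is the symmetric matrix $Q$ with $q(x)=x^tQx$. $\mathrm{SL}^d(K)$ ($d\ge2$) is the set of $K$-Lorentzian forms of degree $d$ in $n$ variables: those $f$ such that for all $a_1,\dots,a_{d-2}\in\mathrm{int}\,K$ the matrix $Q$ of $D_{a_1}\cdots D_{a_{d-2}}f$ has exactly one positive eigenvalue and satisfies $y^tQx>0$ for all $x,y\in\mathrm{int}\,K$. An $n\times n$ matrix $A$ is $K$-nonnegative if $A(K)\subseteq K$. A $K$-nonnegative matrix $A$ is $K$-irreducible if it leaves no proper face of $K$ invariant, i.e. there is no face $F$ of $K$ with $F\ne\{0\}$, $F\neq K$ and $A(F)\subseteq F$. *)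

theory Defs
  imports "HOL-Analysis.Analysis" "HOL-Computational_Algebra.Polynomial"
begin

text \<open>Real forms are represented by their polynomial functions, which determine the coefficients
  because the field is infinite. The zero polynomial counts as a form of every degree.\<close>

definition form :: "nat \<Rightarrow> (real^'n \<Rightarrow> real) \<Rightarrow> bool" where
  "form d f \<longleftrightarrow> (\<exists>c :: ('n \<Rightarrow> nat) \<Rightarrow> real.
     f = (\<lambda>x. \<Sum>\<alpha> | (\<Sum>i\<in>UNIV. \<alpha> i) = d. c \<alpha> * (\<Prod>i\<in>UNIV. (x $ i) ^ \<alpha> i)))"

definition partial_deriv :: "'n \<Rightarrow> (real^'n \<Rightarrow> real) \<Rightarrow> real^'n \<Rightarrow> real" where
  "partial_deriv i f x = deriv (\<lambda>t. f (x + t *\<^sub>R axis i 1)) 0"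

definition dir_deriv :: "real^'n \<Rightarrow> (real^'n \<Rightarrow> real) \<Rightarrow> real^'n \<Rightarrow> real" where
  "dir_deriv a f x = (\<Sum>i\<in>UNIV. a $ i * partial_deriv i f x)"

text \<open>The list \<open>[a\<^sub>1, \<dots>, a\<^sub>m]\<close> stands for the operator \<open>D\<^bsub>a\<^sub>1\<^esub> \<cdots> D\<^bsub>a\<^sub>m\<^esub>\<close>.\<close>

definition iter_dir_deriv :: "(real^'n) list \<Rightarrow> (real^'n \<Rightarrow> real) \<Rightarrow> real^'n \<Rightarrow> real" where
  "iter_dir_deriv as f = foldr dir_deriv as f"

text \<open>The description is proper exactly when \<open>q\<close> is a quadratic form.\<close>

definition form_matrix :: "(real^'n \<Rightarrow> real) \<Rightarrow> real^'n^'n" where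
  "form_matrix q = (THE Q. transpose Q = Q \<and> (\<forall>x. q x = x \<bullet> (Q *v x)))"

definition charpoly :: "real^'n^'n \<Rightarrow> real poly" where
  "charpoly A = det (mat [:0, 1:] - (\<chi> i j. [:A $ i $ j:]))"

text \<open>Eigenvalues are counted with multiplicity: the identity matrix of size \<open>n\<close> has \<open>n\<close>
  positive eigenvalues.\<close>

definition num_pos_eigenvalues :: "real^'n^'n \<Rightarrow> nat" where
  "num_pos_eigenvalues A = size {#l \<in># proots (charpoly A). l > 0#}"

definition dual_cone :: "(real^'n) set \<Rightarrow> (real^'n) set" where
  "dual_cone K = {y. \<forall>x\<in>K. y \<bullet> x \<ge> 0}"

definition self_dual :: "(real^'n) set \<Rightarrow> bool" where
  "self_dual K \<longleftrightarrow> K = dual_cone K"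

definition SL :: "nat \<Rightarrow> (real^'n) set \<Rightarrow> (real^'n \<Rightarrow> real) set" where
  "SL d K = {f. form d f \<and>
     (\<forall>as. length as = d - 2 \<and> set as \<subseteq> interior K \<longrightarrow>
        (let Q = form_matrix (iter_dir_deriv as f) in
          num_pos_eigenvalues Q = 1 \<and>
          (\<forall>x\<in>interior K. \<forall>y\<in>interior K. y \<bullet> (Q *v x) > 0)))}"

definition cone_nonnegative :: "(real^'n) set \<Rightarrow> real^'n^'n \<Rightarrow> bool" where
  "cone_nonnegative K A \<longleftrightarrow> (*v) A ` K \<subseteq> K"

text \<open>The relation \<^const>\<open>face_of\<close> admits the empty set as a face, which is not a face of a cone and
  would be invariant under every matrix; it is therefore excluded.\<close>

definition cone_irreducible :: "(real^'n) set \<Rightarrow> real^'n^'n \<Rightarrow> bool" where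
  "cone_irreducible K A \<longleftrightarrow> cone_nonnegative K A \<and>
     \<not> (\<exists>F. F face_of K \<and> F \<noteq> {} \<and> F \<noteq> {0} \<and> F \<noteq> K \<and> (*v) A ` F \<subseteq> F)"

end

theory Submission
  imports Defs
begin

text \<open>
  The equivalence holds for each matrix \<open>Q\<close> separately: for a symmetric \<open>Q\<close> with exactly one
  positive eigenvalue, positivity of \<open>y \<bullet> Q x\<close> on the interior of \<open>K\<close> is the same as the
  condition on \<open>Q\<close> in terms of the cone (\<open>pos_on_interior_iff\<close>). The form \<open>f\<close> enters only
  through the fact that its iterated derivative is a form of degree two, so that \<open>Q\<close> exists and
  is symmetric (\<open>form_iter_dir_deriv\<close>, \<open>form_matrix_symmetric\<close>).

  Suppose \<open>y \<bullet> Q x > 0\<close> for interior points. The cone is the closure of its interior, so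
  \<open>y \<bullet> Q x \<ge> 0\<close> on \<open>K\<close>, which says that \<open>Q\<close> maps \<open>K\<close> into its dual cone, that is, into \<open>K\<close>.
  Now let \<open>Q\<close> be invertible, and suppose that a proper face \<open>F\<close> is invariant. By self-duality some
  nonzero \<open>w\<close> in \<open>K\<close> is orthogonal to \<open>F\<close> (\<open>proper_face_orthogonal\<close>). For nonzero \<open>x\<close> in \<open>F\<close>
  the mixed term \<open>w \<bullet> Q x\<close> vanishes and \<open>x \<bullet> Q x\<close>, \<open>w \<bullet> Q w\<close> are nonnegative, so the quadratic
  form is positive semidefinite on the plane spanned by \<open>x\<close> and \<open>w\<close>. An invertible symmetric
  matrix with one positive eigenvalue is negative definite on a hyperplane, and every plane meets
  that hyperplane nontrivially: a contradiction (\<open>no_semidefinite_plane\<close>).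

  Conversely, if \<open>Q\<close> maps \<open>K\<close> into itself and \<open>x\<close>, \<open>y\<close> are interior points, then
  \<open>y \<bullet> Q x > 0\<close> unless \<open>Q x = 0\<close>, and \<open>Q x = 0\<close> would force \<open>Q = 0\<close>, which has no positive
  eigenvalue (\<open>nonzero_on_interior\<close>).

  Positive eigenvalues are counted as roots of the characteristic polynomial, so the link to
  definiteness is the diagonalization of symmetric matrices (\<open>symmetric_matrix_diagonalizable\<close>),
  obtained by maximizing Rayleigh quotients on successive orthogonal complements.
\<close>

section \<open>Derivatives of forms\<close>

definition monomial :: "('n \<Rightarrow> nat) \<Rightarrow> real^'n \<Rightarrow> real" where
  "monomial \<alpha> x = (\<Prod>i\<in>UNIV. (x $ i) ^ \<alpha> i)"

lemma finite_exponents: "finite {\<alpha> :: 'n::finite \<Rightarrow> nat. (\<Sum>i\<in>UNIV. \<alpha> i) = d}"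
proof (rule finite_subset)
  show "{\<alpha> :: 'n \<Rightarrow> nat. (\<Sum>i\<in>UNIV. \<alpha> i) = d} \<subseteq> UNIV \<rightarrow>\<^sub>E {..d}"
    by (auto simp: PiE_def intro: member_le_sum)
  show "finite ((UNIV :: 'n set) \<rightarrow>\<^sub>E {..d})"
    by (intro finite_PiE) auto
qed

lemma form_iff_monomials:
  "form d f \<longleftrightarrow> (\<exists>c. f = (\<lambda>x. \<Sum>\<alpha> | (\<Sum>i\<in>UNIV. \<alpha> i) = d. c \<alpha> * monomial \<alpha> x))"
  by (simp add: form_def monomial_def)

lemma form_zero: "form d (\<lambda>x. 0)"
  unfolding form_iff_monomials by (rule exI[of _ "\<lambda>_. 0"]) simp

lemma form_add: "form d (\<lambda>x. f x + g x)" if "form d f" "form d g"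
proof -
  from that obtain b c where
    "f = (\<lambda>x. \<Sum>\<alpha> | (\<Sum>i\<in>UNIV. \<alpha> i) = d. b \<alpha> * monomial \<alpha> x)"
    "g = (\<lambda>x. \<Sum>\<alpha> | (\<Sum>i\<in>UNIV. \<alpha> i) = d. c \<alpha> * monomial \<alpha> x)"
    unfolding form_iff_monomials by blast
  then show ?thesis
    unfolding form_iff_monomials
    by (intro exI[of _ "\<lambda>\<alpha>. b \<alpha> + c \<alpha>"]) (simp add: sum.distrib distrib_right)
qed

lemma form_cmult: "form d (\<lambda>x. r * f x)" if "form d f"
proof -
  from that obtain c where "f = (\<lambda>x. \<Sum>\<alpha> | (\<Sum>i\<in>UNIV. \<alpha> i) = d. c \<alpha> * monomial \<alpha> x)"
    unfolding form_iff_monomials by blast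
  then show ?thesis
    unfolding form_iff_monomials
    by (intro exI[of _ "\<lambda>\<alpha>. r * c \<alpha>"]) (simp add: sum_distrib_left mult.assoc)
qed

lemma form_sum: "form d (\<lambda>x. \<Sum>i\<in>I. f i x)" if "\<And>i. i \<in> I \<Longrightarrow> form d (f i)"
  using that by (induction I rule: infinite_finite_induct) (auto intro: form_zero form_add)

lemma form_monomial: "form (\<Sum>i\<in>UNIV. \<alpha> i) (monomial \<alpha>)"
  unfolding form_iff_monomials
proof (intro exI[of _ "\<lambda>\<beta>. if \<beta> = \<alpha> then 1 else 0"] ext)
  fix x
  have "(\<Sum>\<beta> | sum \<beta> UNIV = sum \<alpha> UNIV. (if \<beta> = \<alpha> then 1 else 0) * monomial \<beta> x)
      = (\<Sum>\<beta> | sum \<beta> UNIV = sum \<alpha> UNIV. if \<beta> = \<alpha> then monomial \<beta> x else 0)"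
    by (intro sum.cong) auto
  also have "\<dots> = monomial \<alpha> x"
    by (simp add: finite_exponents)
  finally show "monomial \<alpha> x
      = (\<Sum>\<beta> | sum \<beta> UNIV = sum \<alpha> UNIV. (if \<beta> = \<alpha> then 1 else 0) * monomial \<beta> x)" ..
qed

lemma monomial_split:
  "monomial \<alpha> x = (x $ i) ^ \<alpha> i * (\<Prod>j\<in>UNIV - {i}. (x $ j) ^ \<alpha> j)"
  by (simp add: monomial_def prod.remove[of UNIV i])

text \<open>The subtraction is truncated: for \<open>\<alpha> i = 0\<close> the monomial on the right is \<open>monomial \<alpha>\<close>
  again, but its coefficient vanishes.\<close>

lemma has_partial_deriv_monomial:
  "((\<lambda>t. monomial \<alpha> (x + t *\<^sub>R axis i 1)) has_real_derivative
     of_nat (\<alpha> i) * monomial (\<alpha>(i := \<alpha> i - 1)) x) (at 0)"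
proof -
  have "(\<lambda>t. monomial \<alpha> (x + t *\<^sub>R axis i 1))
      = (\<lambda>t. (x $ i + t) ^ \<alpha> i * (\<Prod>j\<in>UNIV - {i}. (x $ j) ^ \<alpha> j))"
    by (rule ext) (simp add: monomial_split[of _ _ i] axis_def)
  moreover have "monomial (\<alpha>(i := \<alpha> i - 1)) x
      = (x $ i) ^ (\<alpha> i - 1) * (\<Prod>j\<in>UNIV - {i}. (x $ j) ^ \<alpha> j)"
    by (simp add: monomial_split[of _ _ i])
  ultimately show ?thesis
    by (auto intro!: derivative_eq_intros)
qed

lemma form_partial_deriv:
  assumes "form (Suc d) f"
  shows "form d (partial_deriv i f)"
proof -
  let ?S = "{\<alpha>. (\<Sum>i\<in>UNIV. \<alpha> i) = Suc d}"
  obtain c where f: "f = (\<lambda>x. \<Sum>\<alpha>\<in>?S. c \<alpha> * monomial \<alpha> x)"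
    using assms unfolding form_iff_monomials by blast
  have "partial_deriv i f
      = (\<lambda>x. \<Sum>\<alpha>\<in>?S. (c \<alpha> * \<alpha> i) * monomial (\<alpha>(i := \<alpha> i - 1)) x)"
  proof (rule ext)
    fix x
    have "((\<lambda>t. f (x + t *\<^sub>R axis i 1)) has_real_derivative
        (\<Sum>\<alpha>\<in>?S. c \<alpha> * (\<alpha> i * monomial (\<alpha>(i := \<alpha> i - 1)) x))) (at 0)"
      unfolding f by (intro DERIV_sum DERIV_cmult has_partial_deriv_monomial)
    then show "partial_deriv i f x
        = (\<Sum>\<alpha>\<in>?S. (c \<alpha> * \<alpha> i) * monomial (\<alpha>(i := \<alpha> i - 1)) x)"
      unfolding partial_deriv_def by (simp add: DERIV_imp_deriv mult.assoc)
  qed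
  moreover have "form d (\<lambda>x. (c \<alpha> * \<alpha> i) * monomial (\<alpha>(i := \<alpha> i - 1)) x)"
    if "\<alpha> \<in> ?S" for \<alpha>
  proof (cases "\<alpha> i = 0")
    case True
    then show ?thesis by (simp add: form_zero)
  next
    case False
    have "sum \<alpha> UNIV = \<alpha> i + sum \<alpha> (UNIV - {i})"
      by (simp add: sum.remove)
    moreover have "sum (\<alpha>(i := \<alpha> i - 1)) UNIV = (\<alpha> i - 1) + sum \<alpha> (UNIV - {i})"
      by (simp add: sum.remove[of UNIV i])
    ultimately have "sum (\<alpha>(i := \<alpha> i - 1)) UNIV = d"
      using that False by simp
    then show ?thesis
      using form_cmult[OF form_monomial[of "\<alpha>(i := \<alpha> i - 1)"]] by simp
  qed
  ultimately show ?thesis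
    by (simp only: form_sum)
qed

lemma form_iter_dir_deriv:
  "form (length as + d) f \<Longrightarrow> form d (iter_dir_deriv as f)"
proof (induction as arbitrary: d)
  case Nil
  then show ?case by (simp add: iter_dir_deriv_def)
next
  case (Cons a as)
  then have "form (Suc d) (iter_dir_deriv as f)"
    by simp
  then have "form d (\<lambda>x. \<Sum>i\<in>UNIV. a $ i * partial_deriv i (iter_dir_deriv as f) x)"
    by (intro form_sum form_cmult form_partial_deriv)
  then show ?case
    by (simp add: iter_dir_deriv_def dir_deriv_def[abs_def])
qed

section \<open>The matrix of a quadratic form\<close>

lemma monomial_Suc:
  assumes "sum \<alpha> UNIV = Suc d"
  obtains i \<beta> where "sum \<beta> UNIV = d" "\<And>x. monomial \<alpha> x = x $ i * monomial \<beta> x"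
proof -
  obtain i where i: "\<alpha> i \<noteq> 0"
    using assms by (metis nat.distinct(1) sum.neutral)
  define \<beta> where "\<beta> = \<alpha>(i := \<alpha> i - 1)"
  have "sum \<alpha> UNIV = \<alpha> i + sum \<alpha> (UNIV - {i})"
    by (simp add: sum.remove)
  moreover have "sum \<beta> UNIV = (\<alpha> i - 1) + sum \<alpha> (UNIV - {i})"
    by (simp add: sum.remove[of UNIV i] \<beta>_def)
  ultimately have "sum \<beta> UNIV = d"
    using assms i by simp
  moreover have "monomial \<alpha> x = x $ i * monomial \<beta> x" for x
    using i by (cases "\<alpha> i") (simp_all add: monomial_split[of _ _ i] \<beta>_def)
  ultimately show ?thesis by (rule that)
qed

lemma symmetric_inner:
  fixes Q :: "real^'n^'n"
  assumes "transpose Q = Q"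
  shows "x \<bullet> (Q *v y) = y \<bullet> (Q *v x)"
  by (metis assms dot_lmul_matrix inner_commute transpose_matrix_vector)

lemma quadratic_form_combination:
  fixes Q :: "real^'n^'n"
  assumes "transpose Q = Q"
  shows "(a *\<^sub>R x + b *\<^sub>R y) \<bullet> (Q *v (a *\<^sub>R x + b *\<^sub>R y))
    = a\<^sup>2 * (x \<bullet> (Q *v x)) + 2 * a * b * (x \<bullet> (Q *v y)) + b\<^sup>2 * (y \<bullet> (Q *v y))"
  using symmetric_inner[OF assms, of y x]
  by (simp add: matrix_vector_right_distrib matrix_vector_mult_scaleR inner_add_left
      inner_add_right power2_eq_square algebra_simps)

text \<open>Polarization: over the reals a symmetric matrix is determined by its quadratic form.\<close>

lemma symmetric_matrix_eqI:
  fixes A B :: "real^'n^'n"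
  assumes "transpose A = A" "transpose B = B"
    and "\<And>x. x \<bullet> (A *v x) = x \<bullet> (B *v x)"
  shows "A = B"
proof -
  have "x \<bullet> (A *v y) = x \<bullet> (B *v y)" for x y
    using quadratic_form_combination[OF assms(1), of 1 x 1 y]
      quadratic_form_combination[OF assms(2), of 1 x 1 y]
      assms(3)[of x] assms(3)[of y] assms(3)[of "x + y"] by simp
  then show ?thesis
    by (metis matrix_eq vector_eq_rdot inner_commute)
qed

text \<open>A monomial of degree two is a product of two coordinates, which a matrix with a single
  entry represents; quadratic forms are linear combinations of these.\<close>

lemma quadratic_form_matrix_exists:
  fixes q :: "real^'n \<Rightarrow> real"
  assumes "form 2 q"
  shows "\<exists>Q :: real^'n^'n. \<forall>x. q x = x \<bullet> (Q *v x)"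
proof -
  let ?P = "\<lambda>q. \<exists>Q :: real^'n^'n. \<forall>x. q x = x \<bullet> (Q *v x)"
  have monomial: "?P (monomial \<alpha>)" if "sum \<alpha> UNIV = 2" for \<alpha>
  proof -
    have "sum \<alpha> UNIV = Suc (Suc 0)" using that by simp
    then obtain i \<beta> where \<beta>: "sum \<beta> UNIV = Suc 0" "\<And>x. monomial \<alpha> x = x $ i * monomial \<beta> x"
      by (rule monomial_Suc) blast
    obtain j \<gamma> where \<gamma>: "sum \<gamma> UNIV = 0" "\<And>x. monomial \<beta> x = x $ j * monomial \<gamma> x"
      using monomial_Suc[OF \<beta>(1)] by blast
    have "monomial \<gamma> x = 1" for x
      using \<gamma>(1) by (simp add: monomial_def)
    then have \<alpha>: "monomial \<alpha> x = x $ i * x $ j" for x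
      by (simp add: \<beta> \<gamma>)
    let ?E = "(\<chi> k l. if k = i \<and> l = j then 1 else 0) :: real^'n^'n"
    have "?E *v x = (x $ j) *\<^sub>R axis i 1" for x
      by (auto simp: vec_eq_iff matrix_vector_mult_def axis_def if_distrib[of "\<lambda>r. r * _"]
          cong: if_cong)
    then show ?thesis
      using \<alpha> by (intro exI[of _ ?E]) (simp add: inner_axis)
  qed
  have sum: "?P (\<lambda>x. \<Sum>\<alpha>\<in>A. c \<alpha> * monomial \<alpha> x)"
    if "finite A" "\<And>\<alpha>. \<alpha> \<in> A \<Longrightarrow> sum \<alpha> UNIV = 2"
    for A :: "('n \<Rightarrow> nat) set" and c
    using that
  proof (induction A rule: finite_induct)
    case empty
    then show ?case by (intro exI[of _ 0]) simp
  next
    case (insert \<alpha> A)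
    then obtain Q where Q: "\<forall>x. (\<Sum>\<alpha>\<in>A. c \<alpha> * monomial \<alpha> x) = x \<bullet> (Q *v x)"
      by auto
    obtain R where "\<forall>x. monomial \<alpha> x = x \<bullet> (R *v x)"
      using monomial[of \<alpha>] insert.prems by auto
    with Q insert.hyps show ?case
      by (intro exI[of _ "c \<alpha> *\<^sub>R R + Q"])
        (simp add: matrix_vector_mult_add_rdistrib inner_add_right flip: scaleR_matrix_vector_assoc)
  qed
  obtain c where "q = (\<lambda>x. \<Sum>\<alpha> | sum \<alpha> UNIV = 2. c \<alpha> * monomial \<alpha> x)"
    using assms unfolding form_iff_monomials by blast
  then show ?thesis
    using sum[OF finite_exponents, of 2 c] by simp
qed

text \<open>Averaging an arbitrary representing matrix with its transpose gives the symmetric one.\<close>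

lemma form_matrix_symmetric:
  fixes q :: "real^'n \<Rightarrow> real"
  assumes "form 2 q"
  shows "transpose (form_matrix q) = form_matrix q"
proof -
  obtain B :: "real^'n^'n" where B: "\<forall>x. q x = x \<bullet> (B *v x)"
    using quadratic_form_matrix_exists[OF assms] by blast
  define Q where "Q = (1/2) *\<^sub>R (B + transpose B)"
  have "transpose Q = Q"
    by (simp add: Q_def transpose_def vec_eq_iff)
  moreover have "q x = x \<bullet> (Q *v x)" for x
  proof -
    have "x \<bullet> (transpose B *v x) = x \<bullet> (B *v x)"
      by (metis dot_lmul_matrix inner_commute transpose_matrix_vector)
    then show ?thesis
      using B by (simp add: Q_def matrix_vector_mult_add_rdistrib inner_add_right
          flip: scaleR_matrix_vector_assoc)
  qed
  ultimately have "\<exists>!Q. transpose Q = Q \<and> (\<forall>x. q x = x \<bullet> (Q *v x))"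
    by (intro ex1I[of _ Q]) (auto intro: symmetric_matrix_eqI)
  from theI'[OF this] show ?thesis
    unfolding form_matrix_def by blast
qed

section \<open>Spectral decomposition of symmetric matrices\<close>

text \<open>The first-order condition at a minimum, in the form needed for the Rayleigh quotient.\<close>

lemma linear_coeff_zero_if_quadratic_nonneg:
  fixes b c :: real
  assumes "\<And>t. 2 * t * b + t\<^sup>2 * c \<ge> 0"
  shows "b = 0"
proof (rule ccontr)
  assume "b \<noteq> 0"
  \<comment> \<open>For positive \<open>m > c\<close> the linear term outweighs the quadratic one at \<open>t = - b / m\<close>.\<close>
  define m where "m = \<bar>c\<bar> + 1"
  have m: "m > 0" "c < m" by (auto simp: m_def)
  have "2 * (- b / m) * b + (- b / m)\<^sup>2 * c = b\<^sup>2 / m * (c / m - 2)"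
    using m by (simp add: field_simps power2_eq_square)
  moreover have "b\<^sup>2 / m * (c / m - 2) < 0"
    using m \<open>b \<noteq> 0\<close> by (intro mult_pos_neg) (auto simp: field_simps)
  ultimately show False
    using assms[of "- b / m"] by simp
qed

text \<open>A unit vector of the subspace that maximizes the Rayleigh quotient \<open>v \<bullet> Q v\<close> is an
  eigenvector: the first variation vanishes in every direction of the subspace, in particular
  in the direction \<open>Q v - l v\<close>.\<close>

lemma symmetric_eigenvector_in_subspace:
  fixes Q :: "real^'n^'n"
  assumes sym: "transpose Q = Q" and S: "subspace S"
    and inv: "\<And>x. x \<in> S \<Longrightarrow> Q *v x \<in> S" and z: "z \<in> S" "z \<noteq> 0"
  obtains v l where "v \<in> S" "norm v = 1" "Q *v v = l *\<^sub>R v"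
proof -
  have "compact (S \<inter> sphere 0 1)"
    by (intro closed_Int_compact closed_subspace S compact_sphere)
  moreover have "(1 / norm z) *\<^sub>R z \<in> S \<inter> sphere 0 1"
    using z S by (auto intro: subspace_scale)
  then have "S \<inter> sphere 0 1 \<noteq> {}" by blast
  moreover have "continuous_on (S \<inter> sphere 0 1) (\<lambda>x. x \<bullet> (Q *v x))"
    by (intro continuous_intros)
  ultimately obtain v where "v \<in> S \<inter> sphere 0 1"
    and max: "\<And>x. x \<in> S \<inter> sphere 0 1 \<Longrightarrow> x \<bullet> (Q *v x) \<le> v \<bullet> (Q *v v)"
    using continuous_attains_sup[of "S \<inter> sphere 0 1" "\<lambda>x. x \<bullet> (Q *v x)"] by blast
  then have v: "v \<in> S" "norm v = 1" by auto
  define l where "l = v \<bullet> (Q *v v)"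
  have le: "x \<bullet> (Q *v x) \<le> l * (x \<bullet> x)" if "x \<in> S" for x
  proof (cases "x = 0")
    case False
    have "(1 / norm x) *\<^sub>R x \<in> S \<inter> sphere 0 1"
      using that False S by (auto intro: subspace_scale)
    from max[OF this] show ?thesis
      using False
      by (simp add: l_def matrix_vector_mult_scaleR field_simps flip: power2_norm_eq_inner)
        (simp add: power2_eq_square mult_ac)
  qed simp
  have stationary: "l * (v \<bullet> y) - v \<bullet> (Q *v y) = 0" if "y \<in> S" for y
  proof (rule linear_coeff_zero_if_quadratic_nonneg)
    fix t :: real
    have "v + t *\<^sub>R y \<in> S"
      using v that S by (simp add: subspace_add subspace_scale)
    from le[OF this] have
      "v \<bullet> (Q *v v) + 2 * t * (v \<bullet> (Q *v y)) + t\<^sup>2 * (y \<bullet> (Q *v y))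
        \<le> l * (v \<bullet> v + 2 * t * (v \<bullet> y) + t\<^sup>2 * (y \<bullet> y))"
      using quadratic_form_combination[OF sym, of 1 v t y]
        quadratic_form_combination[of "mat 1" 1 v t y]
      by (simp add: transpose_mat)
    moreover have "v \<bullet> v = 1"
      using v(2) by (simp add: dot_square_norm)
    ultimately show
      "0 \<le> 2 * t * (l * (v \<bullet> y) - v \<bullet> (Q *v y)) + t\<^sup>2 * (l * (y \<bullet> y) - y \<bullet> (Q *v y))"
      by (simp add: l_def[symmetric] algebra_simps)
  qed
  define w where "w = l *\<^sub>R v - Q *v v"
  have "w \<in> S"
    unfolding w_def using v S inv by (intro subspace_diff subspace_scale) auto
  from stationary[OF this] have "l * (v \<bullet> w) - (Q *v v) \<bullet> w = 0"
    using symmetric_inner[OF sym, of v w] by (simp add: inner_commute)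
  then have "(l *\<^sub>R v - Q *v v) \<bullet> w = 0"
    by (simp add: inner_diff_left)
  then have "w \<bullet> w = 0"
    by (simp flip: w_def)
  then have "Q *v v = l *\<^sub>R v"
    by (simp add: w_def)
  with v show ?thesis by (rule that)
qed

text \<open>Eigenvectors are split off one at a time: the orthogonal complement of a set of
  eigenvectors is again invariant under a symmetric matrix.\<close>

lemma orthonormal_eigenvectors_exist:
  fixes Q :: "real^'n^'n"
  assumes sym: "transpose Q = Q"
  shows "k \<le> CARD('n) \<Longrightarrow> \<exists>B. finite B \<and> card B = k \<and> pairwise orthogonal B \<and>
    (\<forall>v\<in>B. norm v = 1 \<and> (\<exists>l. Q *v v = l *\<^sub>R v))"
proof (induction k)
  case 0
  then show ?case by (intro exI[of _ "{}"]) auto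
next
  case (Suc k)
  then obtain B where B: "finite B" "card B = k" "pairwise orthogonal B"
    and eig: "\<And>v. v \<in> B \<Longrightarrow> norm v = 1 \<and> (\<exists>l. Q *v v = l *\<^sub>R v)"
    by auto
  define S where "S = {x. \<forall>v\<in>B. orthogonal v x}"
  have "subspace S"
    by (auto simp: S_def subspace_def orthogonal_def inner_add_right)
  moreover have "Q *v x \<in> S" if "x \<in> S" for x
  proof -
    have "v \<bullet> (Q *v x) = 0" if "v \<in> B" for v
    proof -
      obtain l where "Q *v v = l *\<^sub>R v" using eig[OF \<open>v \<in> B\<close>] by blast
      then show ?thesis
        using \<open>x \<in> S\<close> \<open>v \<in> B\<close> symmetric_inner[OF sym, of v x]
        by (simp add: S_def orthogonal_def inner_commute)
    qed
    then show ?thesis by (simp add: S_def orthogonal_def)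
  qed
  moreover obtain z where "z \<in> S" "z \<noteq> 0"
  proof -
    have "dim B < DIM(real^'n)"
      using dim_le_card'[OF B(1)] B(2) Suc.prems by simp
    then obtain z where "z \<noteq> 0" "\<And>y. y \<in> span B \<Longrightarrow> orthogonal z y"
      by (rule orthogonal_to_subspace_exists) blast
    then have "z \<in> S" "z \<noteq> 0"
      by (auto simp: S_def orthogonal_commute span_base)
    then show ?thesis by (rule that)
  qed
  ultimately obtain v l where v: "v \<in> S" "norm v = 1" "Q *v v = l *\<^sub>R v"
    using symmetric_eigenvector_in_subspace[OF sym] by metis
  have "v \<notin> B"
    using v by (auto simp: S_def orthogonal_def dot_square_norm)
  then show ?case
    using B eig v
    by (intro exI[of _ "insert v B"])
      (auto simp: pairwise_insert S_def orthogonal_commute)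
qed

definition diag :: "('n \<Rightarrow> 'a::zero) \<Rightarrow> 'a^'n^'n" where
  "diag d = (\<chi> i j. if i = j then d i else 0)"

lemma diag_mult_vec: "(diag d *v y) $ i = d i * y $ i" for y :: "real^'n"
  by (simp add: matrix_vector_mult_def diag_def if_distrib[of "\<lambda>r. r * _"] cong: if_cong)

theorem symmetric_matrix_diagonalizable:
  fixes Q :: "real^'n^'n"
  assumes sym: "transpose Q = Q"
  obtains P :: "real^'n^'n" and d where "orthogonal_matrix P" "Q ** P = P ** diag d"
proof -
  obtain B where B: "finite B" "card B = CARD('n)" "pairwise orthogonal B"
    and eig: "\<And>v. v \<in> B \<Longrightarrow> norm v = 1 \<and> (\<exists>l. Q *v v = l *\<^sub>R v)"
    using orthonormal_eigenvectors_exist[OF sym, of "CARD('n)"] by auto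
  obtain v :: "'n \<Rightarrow> real^'n" where v: "bij_betw v UNIV B"
    using finite_same_card_bij[of "UNIV :: 'n set" B] B by auto
  then have vB: "v i \<in> B" for i
    by (auto simp: bij_betw_def)
  then have "\<forall>i. \<exists>l. Q *v v i = l *\<^sub>R v i"
    using eig by blast
  then obtain d where d: "\<And>i. Q *v v i = d i *\<^sub>R v i"
    by (metis choice)
  define P :: "real^'n^'n" where "P = (\<chi> i j. v j $ i)"
  have col: "column i P = v i" for i
    by (simp add: P_def column_def vec_eq_iff)
  have "orthogonal (v i) (v j)" if "i \<noteq> j" for i j
    using pairwiseD[OF B(3) vB vB] that v by (auto simp: bij_betw_def inj_eq)
  then have "orthogonal_matrix P"
    using eig vB by (simp add: orthogonal_matrix_orthonormal_columns col)
  moreover have "Q ** P = P ** diag d"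
  proof -
    have "(Q ** P) $ i $ j = (Q *v v j) $ i" for i j
      by (simp add: matrix_matrix_mult_def matrix_vector_mult_def P_def)
    moreover have "(P ** diag d) $ i $ j = (d j *\<^sub>R v j) $ i" for i j
      by (simp add: matrix_matrix_mult_def diag_def P_def if_distrib[of "\<lambda>r. _ * r"] mult.commute
          cong: if_cong)
    ultimately show ?thesis
      by (simp add: vec_eq_iff d)
  qed
  ultimately show ?thesis by (rule that)
qed

section \<open>Positive eigenvalues and the signature\<close>

text \<open>With real matrices embedded into the matrices over the polynomial ring, the characteristic
  polynomial is a single determinant over that ring, so that multiplicativity of the determinant
  gives its invariance under similarity.\<close>

definition const_poly_matrix :: "real^'n^'n \<Rightarrow> real poly^'n^'n" where
  "const_poly_matrix A = (\<chi> i j. [:A $ i $ j:])"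

lemma const_poly_matrix_mult:
  "const_poly_matrix (A ** B) = const_poly_matrix A ** const_poly_matrix B"
proof -
  have "[:sum f UNIV:] = (\<Sum>k\<in>UNIV. [:f k:])" for f :: "'a \<Rightarrow> real"
    by (rule poly_eqI) (simp add: coeff_sum coeff_pCons split: nat.split)
  then show ?thesis
    by (simp add: const_poly_matrix_def matrix_matrix_mult_def vec_eq_iff mult.commute)
qed

lemma const_poly_matrix_one: "const_poly_matrix (mat 1) = mat 1"
  by (simp add: const_poly_matrix_def mat_def vec_eq_iff)

lemma charpoly_const_poly_matrix: "charpoly A = det (mat [:0, 1:] - const_poly_matrix A)"
  by (simp add: charpoly_def const_poly_matrix_def)

lemma matrix_diff_distrib:
  fixes A B C :: "'a::ring_1^'n^'n"
  shows "A ** (B - C) = A ** B - A ** C" "(B - C) ** A = B ** A - C ** A"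
  by (simp_all add: matrix_matrix_mult_def vec_eq_iff sum_subtractf algebra_simps)

lemma charpoly_similar:
  fixes P P' Q D :: "real^'n^'n"
  assumes "P' ** P = mat 1" "Q ** P = P ** D"
  shows "charpoly Q = charpoly D"
proof -
  let ?C = const_poly_matrix and ?X = "mat [:0, 1:] :: real poly^'n^'n"
  have "?X ** A = A ** ?X" for A
    by (simp add: matrix_matrix_mult_def mat_def vec_eq_iff if_distrib[of "\<lambda>r. r * _"]
        if_distrib[of "\<lambda>r. _ * r"] mult.commute cong: if_cong)
  then have "(?X - ?C Q) ** ?C P = ?C P ** (?X - ?C D)"
    using arg_cong[OF assms(2), of ?C]
    by (simp add: matrix_diff_distrib const_poly_matrix_mult)
  then have "charpoly Q * det (?C P) = det (?C P) * charpoly D"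
    unfolding charpoly_const_poly_matrix by (metis det_mul)
  moreover have "det (?C P') * det (?C P) = 1"
    by (metis assms(1) const_poly_matrix_mult const_poly_matrix_one det_I det_mul)
  ultimately show ?thesis
    by (metis mult.commute mult_cancel_left mult_zero_right zero_neq_one)
qed

lemma charpoly_diag: "charpoly (diag d) = (\<Prod>i\<in>UNIV. [:- d i, 1:])"
proof -
  have "charpoly (diag d) = (\<Prod>i\<in>UNIV. (mat [:0, 1:] - const_poly_matrix (diag d)) $ i $ i)"
    unfolding charpoly_const_poly_matrix
    by (rule det_diagonal) (simp add: mat_def const_poly_matrix_def diag_def)
  then show ?thesis
    by (simp add: mat_def const_poly_matrix_def diag_def)
qed

lemma num_pos_eigenvalues_diag: "num_pos_eigenvalues (diag d) = card {i. d i > 0}"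
proof -
  have "proots (charpoly (diag d)) = (\<Sum>i\<in>UNIV. {#d i#})"
    by (simp add: charpoly_diag proots_prod)
  also have "\<dots> = image_mset d (mset_set UNIV)"
    by (simp add: sum_unfold_sum_mset)
  finally show ?thesis
    by (simp add: num_pos_eigenvalues_def filter_mset_image_mset filter_mset_mset_set)
qed

lemma num_pos_eigenvalues_zero: "num_pos_eigenvalues 0 = 0"
proof -
  have "(0 :: real^'n^'n) = diag (\<lambda>_. 0)"
    by (simp add: diag_def vec_eq_iff)
  then show ?thesis
    by (metis (lifting) Collect_empty_eq card.empty less_irrefl num_pos_eigenvalues_diag)
qed

text \<open>If all eigenvalues but one are negative, then the form is negative definite on the
  hyperplane orthogonal to the exceptional eigenvector. That hyperplane meets every plane
  nontrivially, so no plane can carry a positive semidefinite restriction of the form.\<close>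

lemma no_semidefinite_plane:
  fixes Q :: "real^'n^'n"
  assumes sym: "transpose Q = Q" and inv: "invertible Q" and one: "num_pos_eigenvalues Q = 1"
    and ne: "x \<noteq> 0" "w \<noteq> 0" and orth: "w \<bullet> x = 0"
    and nonneg: "x \<bullet> (Q *v x) \<ge> 0" "w \<bullet> (Q *v w) \<ge> 0" and wQx: "w \<bullet> (Q *v x) = 0"
  shows False
proof -
  obtain P d where P: "orthogonal_matrix P" and QP: "Q ** P = P ** diag d"
    using symmetric_matrix_diagonalizable[OF sym] .
  have PP: "transpose P ** P = mat 1" "P ** transpose P = mat 1"
    using P by (auto simp: orthogonal_matrix_def)
  have "num_pos_eigenvalues Q = card {i. d i > 0}"
    using charpoly_similar[OF PP(1) QP] num_pos_eigenvalues_diag[of d]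
    by (simp add: num_pos_eigenvalues_def)
  then obtain p where p: "{i. d i > 0} = {p}"
    using one card_1_singletonE[of "{i. d i > 0}"] by metis
  have neg: "d i < 0" if "i \<noteq> p" for i
  proof -
    have "det Q * det P = det P * det (diag d)"
      by (metis QP det_mul)
    moreover have "det P \<noteq> 0"
      by (metis PP(1) det_I det_mul mult_zero_right zero_neq_one)
    moreover have "det (diag d) = (\<Prod>i\<in>UNIV. d i)"
      by (subst det_diagonal) (auto simp: diag_def)
    ultimately have "(\<Prod>i\<in>UNIV. d i) \<noteq> 0"
      using inv by (auto simp: invertible_det_nz)
    then have "d i \<noteq> 0" by simp
    moreover have "\<not> d i > 0" using p that by blast
    ultimately show ?thesis by simp
  qed
  \<comment> \<open>The combination of \<open>x\<close> and \<open>w\<close> whose coordinate along the eigenvector \<open>P e\<^sub>p\<close> vanishes.\<close>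
  obtain a b where ab: "a \<noteq> 0 \<or> b \<noteq> 0"
    "a * (transpose P *v x) $ p + b * (transpose P *v w) $ p = 0"
  proof (cases "(transpose P *v x) $ p = 0")
    case True
    then show ?thesis using that[of 1 0] by simp
  next
    case False
    then show ?thesis
      using that[of "(transpose P *v w) $ p" "- (transpose P *v x) $ p"] by simp
  qed
  define z where "z = a *\<^sub>R x + b *\<^sub>R w"
  define y where "y = transpose P *v z"
  have "z \<noteq> 0"
  proof
    assume "z = 0"
    then have "z \<bullet> x = 0" "z \<bullet> w = 0" by auto
    moreover have "z \<bullet> x = a * (x \<bullet> x)" "z \<bullet> w = b * (w \<bullet> w)"
      using orth by (simp_all add: z_def inner_add_left inner_commute[of x w])
    ultimately show False
      using ab(1) ne by auto
  qed
  have yp: "y $ p = 0"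
    using ab(2) by (simp add: y_def z_def matrix_vector_right_distrib matrix_vector_mult_scaleR)
  have z: "z = P *v y"
    by (simp add: y_def matrix_vector_mul_assoc PP del: transpose_matrix_vector)
  with \<open>z \<noteq> 0\<close> have "y \<noteq> 0" by auto
  then obtain i where i: "y $ i \<noteq> 0"
    by (auto simp: vec_eq_iff)
  have "Q *v z = P *v (diag d *v y)"
    by (simp add: z matrix_vector_mul_assoc QP)
  then have "z \<bullet> (Q *v z) = y \<bullet> (diag d *v y)"
    by (simp add: y_def flip: dot_lmul_matrix transpose_matrix_vector)
  also have "\<dots> = (\<Sum>j\<in>UNIV. d j * (y $ j)\<^sup>2)"
    by (simp add: inner_vec_def diag_mult_vec power2_eq_square mult_ac)
  also have "\<dots> < 0"
  proof -
    have le: "d j * (y $ j)\<^sup>2 \<le> 0" for j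
      using neg[of j] yp by (cases "j = p") (auto simp: mult_nonpos_nonneg)
    moreover have "d i * (y $ i)\<^sup>2 < 0"
      using i yp neg[of i] by (cases "i = p") (auto simp: mult_neg_pos)
    ultimately have "(\<Sum>j\<in>UNIV. d j * (y $ j)\<^sup>2) < (\<Sum>j\<in>(UNIV :: 'n set). 0)"
      by (intro sum_strict_mono_ex1) auto
    then show ?thesis by simp
  qed
  finally have "z \<bullet> (Q *v z) < 0" .
  moreover have "z \<bullet> (Q *v z) = a\<^sup>2 * (x \<bullet> (Q *v x)) + b\<^sup>2 * (w \<bullet> (Q *v w))"
    using wQx symmetric_inner[OF sym, of x w]
    by (simp add: z_def quadratic_form_combination[OF sym])
  ultimately show False
    using nonneg by (smt (verit) mult_nonneg_nonneg zero_le_power2)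
qed

section \<open>Self-dual cones\<close>

lemma self_dual_inner_nonneg: "self_dual K \<Longrightarrow> x \<in> K \<Longrightarrow> y \<in> K \<Longrightarrow> x \<bullet> y \<ge> 0"
  unfolding self_dual_def dual_cone_def by blast

lemma self_dual_memI: "self_dual K \<Longrightarrow> (\<And>x. x \<in> K \<Longrightarrow> y \<bullet> x \<ge> 0) \<Longrightarrow> y \<in> K"
  unfolding self_dual_def dual_cone_def by blast

lemma self_dual_zero: "self_dual K \<Longrightarrow> 0 \<in> K"
  by (rule self_dual_memI) auto

lemma self_dual_scale: "self_dual K \<Longrightarrow> x \<in> K \<Longrightarrow> r \<ge> 0 \<Longrightarrow> r *\<^sub>R x \<in> K"
  by (rule self_dual_memI) (auto simp: self_dual_inner_nonneg)

lemma self_dual_closed: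
  assumes "self_dual K"
  shows "closed K"
proof -
  have "dual_cone K = (\<Inter>x\<in>K. {y. x \<bullet> y \<ge> 0})"
    by (auto simp: dual_cone_def inner_commute)
  then have "closed (dual_cone K)"
    by (auto intro: closed_halfspace_ge)
  then show ?thesis
    using assms by (simp add: self_dual_def)
qed

lemma self_dual_convex:
  assumes "self_dual K"
  shows "convex K"
  by (auto simp: convex_def inner_add_left self_dual_inner_nonneg[OF assms]
      intro!: self_dual_memI[OF assms] add_nonneg_nonneg)

text \<open>A normal vector \<open>a\<close> of a hyperplane containing \<open>K\<close> would lie in the dual cone, hence in
  \<open>K\<close>, hence be orthogonal to itself.\<close>

lemma self_dual_interior_nonempty:
  assumes "self_dual K"
  shows "interior K \<noteq> {}"
proof
  assume "interior K = {}"
  then obtain a b where a: "a \<noteq> 0" "K \<subseteq> {x. a \<bullet> x = b}"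
    using empty_interior_subset_hyperplane[OF self_dual_convex[OF assms]] by blast
  then have "b = 0"
    using self_dual_zero[OF assms] by auto
  then have "a \<in> K"
    using a by (intro self_dual_memI[OF assms]) auto
  then have "a \<bullet> a = 0"
    using a \<open>b = 0\<close> by auto
  then show False using a by simp
qed

lemma self_dual_closure_interior: "self_dual K \<Longrightarrow> closure (interior K) = K"
  by (simp add: convex_closure_interior self_dual_convex self_dual_interior_nonempty self_dual_closed)

text \<open>An interior point \<open>y\<close> can be moved a little in the direction of \<open>- x\<close> without leaving the
  cone, and the inner product with \<open>x\<close> is still nonnegative there.\<close>

lemma self_dual_inner_pos:
  assumes K: "self_dual K" and y: "y \<in> interior K" and x: "x \<in> K" "x \<noteq> 0"
  shows "y \<bullet> x > 0"
proof -
  obtain e where e: "e > 0" "cball y e \<subseteq> K"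
    using y by (auto simp: mem_interior_cball)
  have "y - (e / norm x) *\<^sub>R x \<in> K"
    using e x by (intro subsetD[OF e(2)]) (simp add: dist_norm)
  then have "(y - (e / norm x) *\<^sub>R x) \<bullet> x \<ge> 0"
    by (rule self_dual_inner_nonneg[OF K _ x(1)])
  moreover have "(e / norm x) * (x \<bullet> x) > 0"
    using e x by (intro mult_pos_pos) auto
  ultimately show ?thesis by (simp add: inner_diff_left)
qed

lemma self_dual_nonneg_on_closure:
  assumes K: "self_dual K" and "\<And>x. x \<in> interior K \<Longrightarrow> a \<bullet> x \<ge> 0" and "x \<in> K"
  shows "a \<bullet> x \<ge> 0"
proof -
  have "closure (interior K) \<subseteq> {x. a \<bullet> x \<ge> 0}"
    using assms(2) by (intro closure_minimal) (auto intro: closed_halfspace_ge)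
  then show ?thesis
    using \<open>x \<in> K\<close> by (auto simp: self_dual_closure_interior[OF K])
qed

text \<open>A hyperplane that separates the face from the interior of the cone passes through the
  origin, so its normal vector lies in the dual cone, which is the cone itself.\<close>

lemma proper_face_orthogonal:
  assumes K: "self_dual K" and F: "F face_of K" "F \<noteq> {}" "F \<noteq> K"
  obtains w where "w \<in> K" "w \<noteq> 0" "\<And>x. x \<in> F \<Longrightarrow> w \<bullet> x = 0"
proof -
  have "F \<inter> interior K = {}"
    using F by (simp add: face_of_disjoint_interior)
  then obtain w b where w: "w \<noteq> 0" "\<And>x. x \<in> F \<Longrightarrow> w \<bullet> x \<le> b"
    and int: "\<And>x. x \<in> interior K \<Longrightarrow> w \<bullet> x \<ge> b"
    using separating_hyperplane_sets[of F "interior K"] F face_of_imp_convex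
      convex_interior[OF self_dual_convex[OF K]] self_dual_interior_nonempty[OF K]
      self_dual_convex[OF K] by metis
  have "closure (interior K) \<subseteq> {x. w \<bullet> x \<ge> b}"
    using int by (intro closure_minimal) (auto intro: closed_halfspace_ge)
  then have Kb: "w \<bullet> x \<ge> b" if "x \<in> K" for x
    using that by (auto simp: self_dual_closure_interior[OF K])
  have "b \<le> 0"
    using Kb[OF self_dual_zero[OF K]] by simp
  have "w \<bullet> x \<ge> 0" if "x \<in> K" for x
  proof (rule ccontr)
    assume "\<not> w \<bullet> x \<ge> 0"
    then have neg: "w \<bullet> x < 0" by simp
    \<comment> \<open>This multiple of \<open>x\<close> has inner product \<open>b - 1\<close> with \<open>w\<close>.\<close>
    have "((b - 1) / (w \<bullet> x)) *\<^sub>R x \<in> K"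
      using \<open>b \<le> 0\<close> neg by (intro self_dual_scale[OF K that]) (simp add: divide_nonpos_neg)
    from Kb[OF this] neg show False by simp
  qed
  then have "w \<in> K"
    by (rule self_dual_memI[OF K])
  moreover have "w \<bullet> x = 0" if "x \<in> F" for x
    using w(2)[OF that] \<open>b \<le> 0\<close> self_dual_inner_nonneg[OF K \<open>w \<in> K\<close>, of x]
      face_of_imp_subset[OF F(1)] that by fastforce
  ultimately show ?thesis
    using w(1) by (intro that[of w])
qed

section \<open>Positivity on the interior of a self-dual cone\<close>

text \<open>Positivity passes to the closure in each argument in turn, and nonnegativity on \<open>K \<times> K\<close>
  says that \<open>Q\<close> maps \<open>K\<close> into its dual cone.\<close>

lemma cone_nonnegative_if_pos_on_interior:
  assumes K: "self_dual K"
    and pos: "\<And>x y. x \<in> interior K \<Longrightarrow> y \<in> interior K \<Longrightarrow> y \<bullet> (Q *v x) > 0"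
  shows "cone_nonnegative K Q"
  unfolding cone_nonnegative_def
proof (intro image_subsetI self_dual_memI[OF K])
  fix x y assume "x \<in> K" "y \<in> K"
  have "(y v* Q) \<bullet> x' \<ge> 0" if "x' \<in> interior K" for x'
  proof -
    have "(Q *v x') \<bullet> y \<ge> 0"
    proof (rule self_dual_nonneg_on_closure[OF K _ \<open>y \<in> K\<close>])
      fix y' assume "y' \<in> interior K"
      from pos[OF that this] show "(Q *v x') \<bullet> y' \<ge> 0"
        by (simp add: inner_commute)
    qed
    then show ?thesis by (simp add: dot_lmul_matrix inner_commute[of _ y])
  qed
  then have "(y v* Q) \<bullet> x \<ge> 0"
    by (rule self_dual_nonneg_on_closure[OF K _ \<open>x \<in> K\<close>])
  then show "(Q *v x) \<bullet> y \<ge> 0"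
    by (simp add: dot_lmul_matrix inner_commute[of _ y])
qed

text \<open>For an invariant proper face, choose \<open>x\<close> in the face and \<open>w\<close> in the cone orthogonal to
  the face. Then \<open>Q x\<close> is again orthogonal to \<open>w\<close>, and nonnegativity makes the quadratic form
  positive semidefinite on the plane spanned by \<open>x\<close> and \<open>w\<close>, which the signature excludes.\<close>

lemma cone_irreducible_if_invertible:
  assumes K: "self_dual K" and nn: "cone_nonnegative K Q"
    and Q: "transpose Q = Q" "invertible Q" "num_pos_eigenvalues Q = 1"
  shows "cone_irreducible K Q"
  unfolding cone_irreducible_def
proof (intro conjI nn notI)
  assume "\<exists>F. F face_of K \<and> F \<noteq> {} \<and> F \<noteq> {0} \<and> F \<noteq> K \<and> (*v) Q ` F \<subseteq> F"
  then obtain F where F: "F face_of K" "F \<noteq> {}" "F \<noteq> {0}" "F \<noteq> K" "(*v) Q ` F \<subseteq> F"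
    by blast
  obtain w where w: "w \<in> K" "w \<noteq> 0" "\<And>x. x \<in> F \<Longrightarrow> w \<bullet> x = 0"
    using proper_face_orthogonal[OF K F(1,2,4)] by blast
  obtain x where x: "x \<in> F" "x \<noteq> 0"
    using F by blast
  have "x \<in> K"
    using face_of_imp_subset[OF F(1)] x by blast
  have "y \<bullet> (Q *v y) \<ge> 0" if "y \<in> K" for y
    using nn that by (auto simp: cone_nonnegative_def intro: self_dual_inner_nonneg[OF K])
  moreover have "w \<bullet> (Q *v x) = 0"
    using F(5) x w(3) by blast
  ultimately show False
    using no_semidefinite_plane[OF Q x(2) w(2) w(3)[OF x(1)]] \<open>x \<in> K\<close> w(1) by blast
qed

text \<open>If \<open>Q x = 0\<close> for an interior point \<open>x\<close>, then for \<open>z\<close> in the cone the vector \<open>Q z\<close> of the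
  cone is orthogonal to \<open>x\<close>, so it vanishes; as the cone spans the space, \<open>Q = 0\<close>.\<close>

lemma nonzero_on_interior:
  assumes K: "self_dual K" and nn: "cone_nonnegative K Q"
    and sym: "transpose Q = Q" and "Q \<noteq> 0" and x: "x \<in> interior K"
  shows "Q *v x \<noteq> 0"
proof
  assume "Q *v x = 0"
  have zero: "Q *v z = 0" if "z \<in> K" for z
  proof (rule ccontr)
    assume "Q *v z \<noteq> 0"
    moreover have "Q *v z \<in> K"
      using nn that by (auto simp: cone_nonnegative_def)
    ultimately have "x \<bullet> (Q *v z) > 0"
      using self_dual_inner_pos[OF K x] by blast
    moreover have "x \<bullet> (Q *v z) = 0"
      using symmetric_inner[OF sym, of x z] \<open>Q *v x = 0\<close> by simp
    ultimately show False by simp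
  qed
  obtain e where e: "e > 0" "cball x e \<subseteq> K"
    using x by (auto simp: mem_interior_cball)
  have "Q *v z = 0" for z
  proof (cases "z = 0")
    case False
    have "x + (e / norm z) *\<^sub>R z \<in> K"
      using e False by (intro subsetD[OF e(2)]) (simp add: dist_norm)
    from zero[OF this] have "(e / norm z) *\<^sub>R (Q *v z) = 0"
      using \<open>Q *v x = 0\<close> by (simp add: matrix_vector_right_distrib matrix_vector_mult_scaleR)
    then show ?thesis using e False by simp
  qed simp
  then have "Q = 0"
    by (simp add: matrix_eq)
  with \<open>Q \<noteq> 0\<close> show False by simp
qed

lemma pos_on_interior_iff:
  assumes K: "self_dual K" and sym: "transpose Q = Q" and one: "num_pos_eigenvalues Q = 1"
  shows "(\<forall>x\<in>interior K. \<forall>y\<in>interior K. y \<bullet> (Q *v x) > 0) \<longleftrightarrow>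
    (invertible Q \<and> cone_irreducible K Q) \<or> (\<not> invertible Q \<and> cone_nonnegative K Q)"
proof
  assume "\<forall>x\<in>interior K. \<forall>y\<in>interior K. y \<bullet> (Q *v x) > 0"
  then have "cone_nonnegative K Q"
    by (intro cone_nonnegative_if_pos_on_interior[OF K]) auto
  then show "(invertible Q \<and> cone_irreducible K Q) \<or> (\<not> invertible Q \<and> cone_nonnegative K Q)"
    using cone_irreducible_if_invertible[OF K _ sym _ one] by blast
next
  assume "(invertible Q \<and> cone_irreducible K Q) \<or> (\<not> invertible Q \<and> cone_nonnegative K Q)"
  then have nn: "cone_nonnegative K Q"
    by (auto simp: cone_irreducible_def)
  have "Q \<noteq> 0"
    using one by (metis num_pos_eigenvalues_zero zero_neq_one)
  show "\<forall>x\<in>interior K. \<forall>y\<in>interior K. y \<bullet> (Q *v x) > 0"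
  proof (intro ballI)
    fix x y assume x: "x \<in> interior K" and y: "y \<in> interior K"
    have "Q *v x \<in> K"
      using nn x interior_subset by (auto simp: cone_nonnegative_def)
    then show "y \<bullet> (Q *v x) > 0"
      using self_dual_inner_pos[OF K y] nonzero_on_interior[OF K nn sym \<open>Q \<noteq> 0\<close> x] by blast
  qed
qed

theorem theorem5p1:
  fixes f :: "real^'n \<Rightarrow> real" and K :: "(real^'n) set" and d :: nat
  assumes "d \<ge> 2" and "form d f"
    and "convex_cone K" and "self_dual K"
  shows "f \<in> SL d K \<longleftrightarrow>
    (\<forall>as. length as = d - 2 \<and> set as \<subseteq> interior K \<longrightarrow>
      (let Q = form_matrix (iter_dir_deriv as f) in
        ((invertible Q \<and> cone_irreducible K Q) \<or> (\<not> invertible Q \<and> cone_nonnegative K Q)) \<and>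
        num_pos_eigenvalues Q = 1))"
proof -
  have "transpose (form_matrix (iter_dir_deriv as f)) = form_matrix (iter_dir_deriv as f)"
    if "length as = d - 2" for as
  proof -
    have "length as + 2 = d"
      using assms(1) that by simp
    then have "form (length as + 2) f"
      using assms(2) by simp
    then show ?thesis
      by (intro form_matrix_symmetric form_iter_dir_deriv)
  qed
  then show ?thesis
    using pos_on_interior_iff[OF assms(4)] assms(2)
    unfolding SL_def Let_def by blast
qed

end
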